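(* A rhombic dodecahedron $U_3\subset\mathbb{R}^3$ with distance of opposite faces equal to $1$ is a universal cover in $\mathbb{R}^3$; i.e. for every set $X\subset\mathbb{R}^3$ of diameter at most $1$ there exist $A\in O(3)$ and $x\in\mathbb{R}^3$ such that $X\subset AU_3+x$.
   Context: A set $C\subset\mathbb{R}^n$ is called a universal cover in $\mathbb{R}^n$ if for any set $X\subset\mathbb{R}^n$ of diameter at most $1$ there exist $A\in O(n)$ and $x\in\mathbb{R}^n$ with $X\subset AC+x$. The rhombic dodecahedron $U_3$ with distance of opposite faces equal to $1$ is, up to congruence, defined as follows: let $v_1,\dots,v_4$ be the vertices of a regular tetrahedron of edge length $1$ in $\mathbb{R}^3$; for $1\le i<j\le 4$ let $S_{ij}$ be the closed strip (of width $1$) bounded by the two planes orthogonal to the segment $[v_i,v_j]$ and passing through $v_i$ and $v_j$ respectively; then $U_3=\bigcap_{1\le i<j\le 4}S_{ij}$. (Equivalently, up to congruence, $U_3=\{x\in\mathbb{R}^3 : |x_i\pm x_j|\le \sqrt2/2 \text{ for all } 1\le i<j\le 3 \text{ and both signs}\}$.) *)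

theory Defs
  imports "HOL-Analysis.Analysis"
begin

text \<open>The library's diameter is a real supremum, whose value on unbounded sets is
  unspecified; hence the explicit boundedness requirement in the next definition.\<close>

definition universal_cover :: "(real ^ 'n) set \<Rightarrow> bool" where
  "universal_cover C \<longleftrightarrow>
     (\<forall>X. bounded X \<and> diameter X \<le> 1 \<longrightarrow>
        (\<exists>A x. orthogonal_matrix A \<and> X \<subseteq> (\<lambda>y. A *v y + x) ` C))"

text \<open>The closed strip bounded by the hyperplanes through p and through q
  orthogonal to the segment from p to q.\<close>

definition strip :: "'a::real_inner \<Rightarrow> 'a \<Rightarrow> 'a set" where
  "strip p q = {x. p \<bullet> (q - p) \<le> x \<bullet> (q - p) \<and> x \<bullet> (q - p) \<le> q \<bullet> (q - p)}"

definition unit_regular_tetrahedron :: "(nat \<Rightarrow> real ^ 3) \<Rightarrow> bool" where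
  "unit_regular_tetrahedron v \<longleftrightarrow>
     (\<forall>i\<in>{1..4}. \<forall>j\<in>{1..4}. i < j \<longrightarrow> dist (v i) (v j) = 1)"

text \<open>Defined up to congruence: the tetrahedron is arbitrary, so this predicate holds of every
  rhombic dodecahedron whose opposite faces are at distance 1.\<close>

definition unit_rhombic_dodecahedron :: "(real ^ 3) set \<Rightarrow> bool" where
  "unit_rhombic_dodecahedron U \<longleftrightarrow>
     (\<exists>v. unit_regular_tetrahedron v \<and>
          U = (\<Inter>i\<in>{1..4}. \<Inter>j\<in>{i<..4}. strip (v i) (v j)))"

lemma unit_rhombic_dodecahedron_standard:
  "unit_rhombic_dodecahedron
     {x. \<forall>i j. i \<noteq> j \<longrightarrow> \<bar>x $ i + x $ j\<bar> \<le> sqrt 2 / 2 \<and> \<bar>x $ i - x $ j\<bar> \<le> sqrt 2 / 2}"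
    (is "unit_rhombic_dodecahedron ?U")
proof -
  define s :: real where "s = sqrt 2 / 4"
  have s: "s > 0" "8 * (s * s) = 1" "sqrt 2 / 2 = 2 * s"
    by (auto simp: s_def)
  define v :: "nat \<Rightarrow> real ^ 3" where
    "v i = (if i = 1 then vector [s, s, s] else if i = 2 then vector [s, - s, - s]
            else if i = 3 then vector [- s, s, - s] else vector [- s, - s, s])" for i
  have four: "{1..4} = {1, 2, 3, 4::nat}" by auto
  have gt: "{1::nat<..4} = {2, 3, 4}" "{2::nat<..4} = {3, 4}" "{3::nat<..4} = {4}"
    "{Suc 0<..4} = {2, 3, 4}" "{4::nat<..4} = {}"
    by auto
  have tet: "unit_regular_tetrahedron v"
    unfolding unit_regular_tetrahedron_def four
    using s(2)
    by (auto simp: v_def dist_norm norm_eq_sqrt_inner inner_vec_def sum_3)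
  have red: "2 * (s * a) \<le> 4 * (s * s) \<longleftrightarrow> a \<le> 2 * s"
            "- (4 * (s * s)) \<le> 2 * (s * a) \<longleftrightarrow> - (2 * s) \<le> a" for a
  proof -
    have "2 * (s * a) \<le> 4 * (s * s) \<longleftrightarrow> (2 * s) * a \<le> (2 * s) * (2 * s)"
      by (simp add: algebra_simps)
    also have "\<dots> \<longleftrightarrow> a \<le> 2 * s" using s(1) by (subst mult_le_cancel_left_pos) auto
    finally show "2 * (s * a) \<le> 4 * (s * s) \<longleftrightarrow> a \<le> 2 * s" .
    have "- (4 * (s * s)) \<le> 2 * (s * a) \<longleftrightarrow> (2 * s) * (- (2 * s)) \<le> (2 * s) * a"
      by (simp add: algebra_simps)
    also have "\<dots> \<longleftrightarrow> - (2 * s) \<le> a" using s(1) by (subst mult_le_cancel_left_pos) auto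
    finally show "- (4 * (s * s)) \<le> 2 * (s * a) \<longleftrightarrow> - (2 * s) \<le> a" .
  qed
  have st: "x \<in> strip p q \<longleftrightarrow> \<bar>a\<bar> \<le> 2 * s"
    if "p \<bullet> (q - p) = - (4 * (s * s))" "q \<bullet> (q - p) = 4 * (s * s)"
       "x \<bullet> (q - p) = 2 * (s * a)" for x p q :: "real ^ 3" and a
    unfolding strip_def mem_Collect_eq that red by auto
  note ev = v_def inner_vec_def sum_3 algebra_simps
  have e: "x \<in> strip (v 1) (v 2) \<longleftrightarrow> \<bar>- x $ 2 - x $ 3\<bar> \<le> 2 * s"
    "x \<in> strip (v 1) (v 3) \<longleftrightarrow> \<bar>- x $ 1 - x $ 3\<bar> \<le> 2 * s"
    "x \<in> strip (v 1) (v 4) \<longleftrightarrow> \<bar>- x $ 1 - x $ 2\<bar> \<le> 2 * s"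
    "x \<in> strip (v 2) (v 3) \<longleftrightarrow> \<bar>x $ 2 - x $ 1\<bar> \<le> 2 * s"
    "x \<in> strip (v 2) (v 4) \<longleftrightarrow> \<bar>x $ 3 - x $ 1\<bar> \<le> 2 * s"
    "x \<in> strip (v 3) (v 4) \<longleftrightarrow> \<bar>x $ 3 - x $ 2\<bar> \<le> 2 * s" for x
    by (rule st; simp add: ev)+
  have "?U = (\<Inter>i\<in>{1..4}. \<Inter>j\<in>{i<..4}. strip (v i) (v j))"
    unfolding four s(3)
    by (rule set_eqI) (simp add: gt e[simplified] forall_3, argo)
  with tet show ?thesis
    unfolding unit_rhombic_dodecahedron_def by blast
qed

end

theory Submission
  imports Defs "HOL-Library.Z2"
begin

text \<open>
  Let \<open>X\<close> have diameter at most 1 and let \<open>f u\<close> be the midpoint of the interval spanned by the values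
  \<open>p \<bullet> u\<close> for \<open>p \<in> X\<close>. This is a continuous odd function, and \<open>X\<close> lies in the strip of width 1 that
  is orthogonal to \<open>u\<close> and centred at the level \<open>f u\<close>. The face normals of a rhombic dodecahedron
  are the twelve vectors \<open>\<plusminus> p \<plusminus> q\<close>, \<open>\<plusminus> p \<plusminus> r\<close>, \<open>\<plusminus> q \<plusminus> r\<close> for an orthonormal frame \<open>p\<close>, \<open>q\<close>, \<open>r\<close>.
  So the dodecahedron with this frame and centre \<open>v\<close> contains \<open>X\<close> once \<open>f u = v \<bullet> u\<close> for these
  twelve \<open>u\<close>, and it suffices to find a frame on which \<open>f\<close> is linear in this sense
  (\<open>odd_function_linear_on_frame_sums\<close>).

  The twelve vectors split into four triples \<open>T\<^sub>0, \<dots>, T\<^sub>3\<close> with sum zero, each consisting of every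
  second vertex of a regular hexagon. The sums of \<open>f\<close> over the triples add up to 0, and \<open>f\<close> is linear
  as soon as the four sums are equal (\<open>linear_of_equal_hexagons\<close>). Label a frame by the index of a
  largest sum. The symmetries of the cube that preserve the axis of \<open>r\<close> permute the four triples
  like the symmetries of a square permute its corners, and frames related by such a symmetry have
  labels related in the same way. What is needed is a frame that has all four labels, or, by
  compactness, arbitrarily small sets of frames on which all four labels occur
  (\<open>equivariant_coincidence\<close>).

  That such sets exist is a parity argument (\<open>rainbow_cube_exists\<close>). In Euler angles the frames form
  a box, and the symmetries become translations and reflections that glue its faces. If no small cube
  of a grid in the box showed all labels, the labelling would be a map to the surface of a
  tetrahedron, whose degree modulo 2 on the levels of constant middle angle, corrected by a count
  along the rim where the level is cut open, would not depend on the level. On the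
  bottom level, where the frame depends only on the sum of the other two angles, this number is odd;
  on the top level, where the gluing pairs off the squares, it is even.
\<close>

section \<open>Degrees modulo 2 of labelled grids\<close>

text \<open>Labels in \<open>\<int>/4\<close> are read as the vertices of a tetrahedron, so that a labelled grid becomes
  a map to the tetrahedron, and degrees are counted modulo 2. A step of a path is counted when it
  crosses the side with end points 1 and 2.\<close>

definition edge :: "4 \<Rightarrow> 4 \<Rightarrow> bit" where
  "edge a b = of_bool (a = 1 \<and> b = 2 \<or> a = 2 \<and> b = 1)"

text \<open>The degree modulo 2 of a labelled square over the facet 123 of the tetrahedron: without the
  label 0, the boundary of the square runs around that triangle as often, modulo 2, as it crosses
  one of its sides. A square that shows 0 and misses another label does not reach the interior of the
  facet; for a square that shows all four labels the value is a convention.\<close>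

definition face :: "4 \<Rightarrow> 4 \<Rightarrow> 4 \<Rightarrow> 4 \<Rightarrow> bit" where
  "face a b c d =
     (if 0 \<in> {a, b, c, d} then 0 else edge a b + edge b c + edge c d + edge d a)"

definition parity :: "4 \<Rightarrow> bit" where
  "parity a = of_bool (a = 1 \<or> a = 3)"

lemma all_4: "(\<forall>a::4. P a) \<longleftrightarrow> P 0 \<and> P 1 \<and> P 2 \<and> P 3"
proof -
  have "(4::4) = 0" by simp
  then show ?thesis using forall_4[of P] by metis
qed

text \<open>Over the four rotations of the label cycle, the jumps counted are those between neighbouring
  labels, and these are the jumps that change the parity of the label.\<close>

lemma edge_shifts: "edge a b + edge (a+1) (b+1) + edge (a+2) (b+2) + edge (a+3) (b+3)
   = parity a + parity b"
proof -
  have "\<forall>a b. edge a b + edge (a+1) (b+1) + edge (a+2) (b+2) + edge (a+3) (b+3)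
   = parity a + parity b"
    unfolding all_4 by (simp add: edge_def parity_def)
  then show ?thesis by blast
qed

text \<open>After the shift, the degree over the facet 123 becomes the degree of the original square over
  the facet 012. These two facets share the side 12, so their degrees differ by the number of times
  that the boundary of the square crosses it.\<close>

lemma face_shift:
  assumes "x \<notin> {a, b, c, d}"
  shows "face a b c d + face (a+1) (b+1) (c+1) (d+1) = edge a b + edge b c + edge c d + edge d a"
proof -
  have "\<forall>a b c d. \<not> {0, 1, 2, 3} \<subseteq> {a, b, c, d} \<longrightarrow>
      face a b c d + face (a+1) (b+1) (c+1) (d+1) = edge a b + edge b c + edge c d + edge d a"
    unfolding all_4 by (simp add: face_def edge_def)
  moreover have "\<forall>x::4. x \<in> {0, 1, 2, 3}"
    unfolding all_4 by simp
  ultimately show ?thesis using assms by blast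
qed

lemma face_reflect: "face (-d) (-c) (-b) (-a) = face a b c d"
proof -
  have "\<forall>a b c d. face (-d) (-c) (-b) (-a) = face a b c d"
    unfolding all_4 by (simp add: face_def edge_def)
  then show ?thesis by blast
qed

lemma edge_reflect: "edge (-1-a) (-1-b) = edge a b"
proof -
  have "\<forall>a b. edge (-1-a) (-1-b) = edge a b"
    unfolding all_4 by (simp add: edge_def)
  then show ?thesis by blast
qed

text \<open>A square whose opposite corners agree maps onto a path that is run through forwards and back.\<close>

lemma face_fold: "face a b c b = 0"
  by (auto simp: face_def edge_def)

lemma face_without:
  assumes "x \<notin> {a, b, c, d}" "x \<noteq> 0" shows "face a b c d = 0"
proof -
  have "\<forall>x a b c d. x \<notin> {a, b, c, d} \<and> x \<noteq> 0 \<longrightarrow> face a b c d = 0"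
    unfolding all_4 by (simp add: face_def edge_def)
  then show ?thesis using assms by blast
qed

lemma bit_add_self: "x + x = (0::bit)" "x + (x + y) = (y::bit)"
  by (cases x; cases y; simp)+

lemma edge_commute: "edge a b = edge b a"
  by (auto simp: edge_def)

text \<open>The surface of a cube that misses a label is mapped to a tetrahedron surface without one vertex,
  which is contractible; hence its total degree vanishes. If the missing label is 0, every edge of
  the cube is counted twice; if it is another one, the facet 123 is never reached.\<close>

lemma cube_boundary:
  assumes "x \<notin> {a, b, c, d, a', b', c', d'}"
  shows "face a b c d + face a' b' c' d' =
    (face a b b' a' + face d c c' d') + (face a d d' a' + face b c c' b')"
proof (cases "x = 0")
  case True
  then have f: "face p q r s = edge p q + edge q r + edge r s + edge s p"
    if "{p, q, r, s} \<subseteq> {a, b, c, d, a', b', c', d'}" for p q r s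
  proof -
    have "0 \<notin> {p, q, r, s}" using that assms \<open>x = 0\<close> by blast
    then show ?thesis by (simp only: face_def if_False)
  qed
  have fs: "face a b c d = edge a b + edge b c + edge c d + edge d a"
    "face a' b' c' d' = edge a' b' + edge b' c' + edge c' d' + edge d' a'"
    "face a b b' a' = edge a b + edge b b' + edge b' a' + edge a' a"
    "face d c c' d' = edge d c + edge c c' + edge c' d' + edge d' d"
    "face a d d' a' = edge a d + edge d d' + edge d' a' + edge a' a"
    "face b c c' b' = edge b c + edge c c' + edge c' b' + edge b' b"
    by (rule f; blast)+
  show ?thesis
    unfolding fs by (simp only: edge_commute bit_add_self add_ac add_0_left)
next
  case False
  then show ?thesis using assms by (simp add: face_without[of x])
qed

lemma sum_telescope_bit: "(\<Sum>i<n. f i + f (Suc i)) = f 0 + (f n :: bit)" for n :: nat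
  by (induction n) (auto simp: bit_add_self add_ac)

lemma sum_lessThan_add: "(\<Sum>i<m + n. f i) = (\<Sum>i<m. f i) + (\<Sum>i<n. f (i + m))"
  for f :: "nat \<Rightarrow> 'a::comm_monoid_add"
  by (induction n) (auto simp: ac_simps)

lemma sum_halves: "(\<Sum>i<4 * n. f i) = (\<Sum>i<2 * n. f i + f (i + 2 * n))"
  for f :: "nat \<Rightarrow> 'a::comm_monoid_add"
proof -
  have "4 * n = 2 * n + 2 * n" by simp
  then show ?thesis by (simp only: sum_lessThan_add sum.distrib)
qed

lemma sum_blocks: "(\<Sum>i<4 * n. f i) = (\<Sum>i<n. f i + f (i + n) + f (i + 2 * n) + f (i + 3 * n))"
  for f :: "nat \<Rightarrow> 'a::comm_monoid_add"
proof -
  have "4 * n = n + n + n + n" by simp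
  moreover have "i + (n + n) = i + 2 * n" "i + (n + n + n) = i + 3 * n" for i by simp_all
  ultimately show ?thesis by (simp only: sum_lessThan_add sum.distrib)
qed

text \<open>The hypotheses describe the labels of frames on a grid of Euler angles: \<open>i\<close> runs through a full
  turn of \<open>4 * n\<close> steps, \<open>j\<close> and \<open>k\<close> through quarter turns, and two symmetries of the frame act on the
  labels by \<open>x \<mapsto> x + 1\<close> and \<open>x \<mapsto> - x\<close>.

  Suppose that every cube misses a label. Let \<open>t j\<close> be the degree modulo 2 of the level \<open>j\<close>, cut
  open along \<open>k = 0\<close>. Between two levels this degree changes by what passes through the walls of the
  cut, \<open>k = 0\<close> and \<open>k = n\<close>, whose labels differ by the shift; by \<open>face_shift\<close> that is the change of
  the number \<open>e j\<close> of jumps between 1 and 2 along the rim \<open>k = 0\<close>. So \<open>t j + e j\<close> does not depend on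
  \<open>j\<close>. But it is 1 at the bottom, where the level collapses to a loop and a parity change
  remains, and 0 at the top, where the flip pairs squares with squares and rim steps with rim
  steps.\<close>

lemma rainbow_cube_exists:
  fixes l :: "nat \<Rightarrow> nat \<Rightarrow> nat \<Rightarrow> 4"
  assumes periodic: "\<And>j k. j \<le> n \<Longrightarrow> k \<le> n \<Longrightarrow> l (4 * n) j k = l 0 j k"
    and shift: "\<And>i j. i \<le> 4 * n \<Longrightarrow> j \<le> n \<Longrightarrow> l i j n = l i j 0 + 1"
    and flip: "\<And>i k. i \<le> 2 * n \<Longrightarrow> k \<le> n \<Longrightarrow> l (i + 2 * n) n (n - k) = - l i n k"
    and collapse: "\<And>i k. i \<le> 4 * n \<Longrightarrow> k \<le> n \<Longrightarrow> l i 0 k = L (i + k)"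
    and collapse_shift: "\<And>m. L (m + n) = L m + 1"
  shows "\<exists>i<4 * n. \<exists>j<n. \<exists>k<n.
    \<forall>x. \<exists>i'\<in>{i, Suc i}. \<exists>j'\<in>{j, Suc j}. \<exists>k'\<in>{k, Suc k}. l i' j' k' = x"
proof (rule ccontr)
  assume no: "\<not> ?thesis"
  define t where "t j = (\<Sum>i<4 * n. \<Sum>k<n.
    face (l i j k) (l (Suc i) j k) (l (Suc i) j (Suc k)) (l i j (Suc k)))" for j
  define e where "e j = (\<Sum>i<4 * n. edge (l i j 0) (l (Suc i) j 0))" for j
  define W where "W i j k = face (l i j k) (l (Suc i) j k) (l (Suc i) (Suc j) k) (l i (Suc j) k)"
    for i j k
  define V where "V i j k = face (l i j k) (l i j (Suc k)) (l i (Suc j) (Suc k)) (l i (Suc j) k)"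
    for i j k
  have missing: "\<exists>x. x \<notin> {l i j k, l (Suc i) j k, l (Suc i) j (Suc k), l i j (Suc k),
      l i (Suc j) k, l (Suc i) (Suc j) k, l (Suc i) (Suc j) (Suc k), l i (Suc j) (Suc k)}"
    if "i < 4 * n" "j < n" "k < n" for i j k
  proof -
    from no that obtain x where
      "\<And>i' j' k'. i' \<in> {i, Suc i} \<Longrightarrow> j' \<in> {j, Suc j} \<Longrightarrow> k' \<in> {k, Suc k} \<Longrightarrow> l i' j' k' \<noteq> x"
      by blast
    then show ?thesis by (intro exI[of _ x]) (simp, metis)
  qed
  \<comment> \<open>The layer of cubes between the levels \<open>j\<close> and \<open>j + 1\<close>: interior walls cancel.\<close>
  have step: "t j + e j = t (Suc j) + e (Suc j)" if "j < n" for j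
  proof -
    have "t j + t (Suc j) = (\<Sum>i<4 * n. \<Sum>k<n. (W i j k + W i j (Suc k)) + (V i j k + V (Suc i) j k))"
      unfolding t_def sum.distrib[symmetric] W_def V_def
    proof (intro sum.cong refl)
      fix i k assume "i \<in> {..<4 * n}" "k \<in> {..<n}"
      then have ik: "i < 4 * n" "k < n" by auto
      from missing[OF ik(1) that ik(2)] obtain x where x: "x \<notin> {l i j k, l (Suc i) j k,
          l (Suc i) j (Suc k), l i j (Suc k), l i (Suc j) k, l (Suc i) (Suc j) k,
          l (Suc i) (Suc j) (Suc k), l i (Suc j) (Suc k)}" by (rule exE)
      show "face (l i j k) (l (Suc i) j k) (l (Suc i) j (Suc k)) (l i j (Suc k)) +
          face (l i (Suc j) k) (l (Suc i) (Suc j) k) (l (Suc i) (Suc j) (Suc k)) (l i (Suc j) (Suc k)) =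
        (face (l i j k) (l (Suc i) j k) (l (Suc i) (Suc j) k) (l i (Suc j) k) +
         face (l i j (Suc k)) (l (Suc i) j (Suc k)) (l (Suc i) (Suc j) (Suc k)) (l i (Suc j) (Suc k))) +
        (face (l i j k) (l i j (Suc k)) (l i (Suc j) (Suc k)) (l i (Suc j) k) +
         face (l (Suc i) j k) (l (Suc i) j (Suc k)) (l (Suc i) (Suc j) (Suc k)) (l (Suc i) (Suc j) k))"
        by (rule cube_boundary[OF x])
    qed
    also have "\<dots> = (\<Sum>i<4 * n. \<Sum>k<n. W i j k + W i j (Suc k))
        + (\<Sum>k<n. \<Sum>i<4 * n. V i j k + V (Suc i) j k)"
      by (subst sum.swap[of "\<lambda>k i. V i j k + V (Suc i) j k"]) (simp only: sum.distrib)
    \<comment> \<open>The first and the last wall of the full turn coincide.\<close>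
    also have "(\<Sum>k<n. \<Sum>i<4 * n. V i j k + V (Suc i) j k) = 0"
    proof (rule sum.neutral, rule ballI)
      fix k assume "k \<in> {..<n}"
      then have "V (4 * n) j k = V 0 j k" using that by (simp add: V_def periodic)
      then show "(\<Sum>i<4 * n. V i j k + V (Suc i) j k) = 0"
        by (simp only: sum_telescope_bit[of "\<lambda>i. V i j k"] bit_add_self)
    qed
    also have "(\<Sum>i<4 * n. \<Sum>k<n. W i j k + W i j (Suc k)) = (\<Sum>i<4 * n. W i j 0 + W i j n)"
      by (simp only: sum_telescope_bit)
    also have "\<dots> = (\<Sum>i<4 * n. (edge (l i j 0) (l (Suc i) j 0)
        + edge (l i (Suc j) 0) (l (Suc i) (Suc j) 0))
        + (edge (l i j 0) (l i (Suc j) 0) + edge (l (Suc i) j 0) (l (Suc i) (Suc j) 0)))"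
    proof (intro sum.cong refl)
      fix i assume i: "i \<in> {..<4 * n}"
      have "n > 0" using that by simp
      with i missing[of i j 0] that
      obtain x where x: "x \<notin> {l i j 0, l (Suc i) j 0, l (Suc i) (Suc j) 0, l i (Suc j) 0}"
        by auto
      have "W i j n = face (l i j 0 + 1) (l (Suc i) j 0 + 1) (l (Suc i) (Suc j) 0 + 1) (l i (Suc j) 0 + 1)"
        using i that by (simp add: W_def shift)
      then have "W i j 0 + W i j n = edge (l i j 0) (l (Suc i) j 0)
        + edge (l (Suc i) j 0) (l (Suc i) (Suc j) 0)
        + edge (l (Suc i) (Suc j) 0) (l i (Suc j) 0) + edge (l i (Suc j) 0) (l i j 0)"
        unfolding W_def[of i j 0] by (simp only: face_shift[OF x])
      then show "W i j 0 + W i j n = (edge (l i j 0) (l (Suc i) j 0)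
        + edge (l i (Suc j) 0) (l (Suc i) (Suc j) 0))
        + (edge (l i j 0) (l i (Suc j) 0) + edge (l (Suc i) j 0) (l (Suc i) (Suc j) 0))"
        by (simp only: add_ac edge_commute)
    qed
    also have "\<dots> = e j + e (Suc j) + (edge (l 0 j 0) (l 0 (Suc j) 0) + edge (l (4 * n) j 0) (l (4 * n) (Suc j) 0))"
      by (simp only: sum.distrib[of "\<lambda>i. edge (l i j 0) (l (Suc i) j 0) + edge (l i (Suc j) 0) (l (Suc i) (Suc j) 0)"]
        sum_telescope_bit[of "\<lambda>i. edge (l i j 0) (l i (Suc j) 0)"])
        (simp only: e_def sum.distrib)
    also have "\<dots> = e j + e (Suc j)"
      using that by (simp only: periodic[of j 0] periodic[of "Suc j" 0] bit_add_self add_0_right Suc_leI less_imp_le le0)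
    finally have "t j + t (Suc j) = e j + e (Suc j)"
      by (simp only: add_0_right)
    then show ?thesis by (cases "t j"; cases "t (Suc j)"; cases "e j"; cases "e (Suc j)") simp_all
  qed
  have const: "t 0 + e 0 = t j + e j" if "j \<le> n" for j
    using that
  proof (induction j)
    case (Suc j)
    then show ?case using step[of j] by (metis Suc_le_lessD less_imp_le)
  qed simp
  have "t 0 = 0"
    unfolding t_def by (intro sum.neutral ballI) (simp add: collapse face_fold)
  \<comment> \<open>Grouping the loop into its four quarters turns crossings of 12 into changes of parity,
    and a quarter turn adds 1 to the label.\<close>
  moreover have "e 0 = 1"
  proof -
    have L: "L (i + 2 * n) = L i + 2" "L (i + 3 * n) = L i + 3" for i
      using collapse_shift[of i] collapse_shift[of "i + n"] collapse_shift[of "i + n + n"]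
      by (simp_all add: add_ac mult_2 numeral_3_eq_3)
    have "e 0 = (\<Sum>i<4 * n. edge (L i) (L (Suc i)))"
      by (simp add: e_def collapse)
    also have "\<dots> = (\<Sum>i<n. parity (L i) + parity (L (Suc i)))"
      unfolding sum_blocks using collapse_shift L
      by (intro sum.cong refl) (simp only: edge_shifts[symmetric] flip: add_Suc)
    also have "\<dots> = parity (L 0) + parity (L 0 + 1)"
      using collapse_shift[of 0] by (simp only: sum_telescope_bit[of "\<lambda>i. parity (L i)"]) simp
    also have "\<dots> = 1"
    proof -
      have "\<forall>a. parity a + parity (a + 1) = 1" unfolding all_4 by (simp add: parity_def)
      then show ?thesis by blast
    qed
    finally show ?thesis .
  qed
  \<comment> \<open>The flip maps the half \<open>i < 2 * n\<close> of the top level onto the other half and fixes label 0.\<close>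
  moreover have "t n = 0"
  proof -
    define F where "F i k = face (l i n k) (l (Suc i) n k) (l (Suc i) n (Suc k)) (l i n (Suc k))" for i k
    have "F (i + 2 * n) (n - Suc k) = F i k" if "i < 2 * n" "k < n" for i k
    proof -
      have "Suc (n - Suc k) = n - k" using that by simp
      then show ?thesis
        using that flip[of i k] flip[of i "Suc k"] flip[of "Suc i" k] flip[of "Suc i" "Suc k"]
        by (simp add: F_def face_reflect)
    qed
    then have *: "(\<Sum>k<n. F (i + 2 * n) k) = (\<Sum>k<n. F i k)" if "i < 2 * n" for i
      using that by (subst sum.nat_diff_reindex[symmetric]) simp
    have "t n = (\<Sum>i<2 * n. (\<Sum>k<n. F i k) + (\<Sum>k<n. F (i + 2 * n) k))"
      by (simp only: t_def sum_halves F_def)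
    also have "\<dots> = 0"
      using * by (intro sum.neutral) (auto simp: bit_add_self)
    finally show ?thesis .
  qed
  \<comment> \<open>On the rim the shift followed by the flip acts as \<open>x \<mapsto> - 1 - x\<close>, which exchanges 1 and 2.\<close>
  moreover have "e n = 0"
  proof -
    have *: "l (i + 2 * n) n 0 = - 1 - l i n 0" if "i \<le> 2 * n" for i
      using flip[of i n] shift[of i n] that by simp
    have "edge (l (i + 2 * n) n 0) (l (Suc (i + 2 * n)) n 0) = edge (l i n 0) (l (Suc i) n 0)"
      if "i < 2 * n" for i
      using *[of i] *[of "Suc i"] that by (simp add: edge_reflect)
    then show ?thesis
      unfolding e_def sum_halves by (intro sum.neutral) (auto simp: bit_add_self)
  qed
  ultimately show False using const[of n] by simp
qed

section \<open>Coincidence of four equivariant functions\<close>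

text \<open>Each grid point is labelled by the index of a largest component of \<open>H\<close>. Where there are ties, a
  choice for each point alone would break the symmetry, so the choice is made on a fundamental domain
  of the grid and carried over to the other points by the symmetries.\<close>

lemma equivariant_labels:
  fixes H :: "real \<Rightarrow> real \<Rightarrow> real \<Rightarrow> 4 \<Rightarrow> real"
  assumes periodic: "\<And>a b c. H (a + 4) b c = H a b c"
    and shift: "\<And>a b c x. H a b (c + 1) (x + 1) = H a b c x"
    and flip: "\<And>a c x. H (a + 2) 1 (- c) (- 1 - x) = H a 1 c x"
    and collapse: "\<And>a c. H a 0 c = H 0 0 (a + c)"
    and "n > 0"
  obtains l :: "nat \<Rightarrow> nat \<Rightarrow> nat \<Rightarrow> 4" and L where
    "\<And>j k. j \<le> n \<Longrightarrow> k \<le> n \<Longrightarrow> l (4 * n) j k = l 0 j k"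
    "\<And>i j. i \<le> 4 * n \<Longrightarrow> j \<le> n \<Longrightarrow> l i j n = l i j 0 + 1"
    "\<And>i k. i \<le> 2 * n \<Longrightarrow> k \<le> n \<Longrightarrow> l (i + 2 * n) n (n - k) = - l i n k"
    "\<And>i k. i \<le> 4 * n \<Longrightarrow> k \<le> n \<Longrightarrow> l i 0 k = L (i + k)"
    "\<And>m. L (m + n) = L m + 1"
    "\<And>i j k y. j \<le> n \<Longrightarrow> k \<le> n \<Longrightarrow>
       H (i / n) (j / n) (k / n) y \<le> H (i / n) (j / n) (k / n) (l i j k)"
proof -
  have per: "H (a + 4 * real m) b c = H a b c" for a b c m
  proof (induction m)
    case (Suc m)
    then show ?case using periodic[of "a + 4 * real m" b c] by (simp add: algebra_simps)
  qed simp
  have sh: "H a b (c + real m) (x + of_nat m) = H a b c x" for a b c m x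
  proof (induction m)
    case (Suc m)
    then show ?case using shift[of a b "c + real m" "x + of_nat m"] by (simp add: algebra_simps)
  qed simp
  define best where "best a b c = (SOME x. \<forall>y. H a b c y \<le> H a b c x)" for a b c
  have best: "H a b c y \<le> H a b c (best a b c)" for a b c y
  proof -
    have "\<exists>x. \<forall>y. H a b c y \<le> H a b c x"
      using Max_in[of "range (H a b c)"] Max_ge[of "range (H a b c)"] by fastforce
    from someI_ex[OF this] show ?thesis unfolding best_def by blast
  qed
  \<comment> \<open>Choices are made for quarter-turn residues only and then shifted.\<close>
  define raw where "raw a b k = best a b (real (k mod n) / n) + of_nat (k div n)" for a b k
  have raw_shift: "raw a b (k + n) = raw a b k + 1" for a b k
    using \<open>n > 0\<close> by (simp add: raw_def add_ac)
  have raw: "H a b (k / n) y \<le> H a b (k / n) (raw a b k)" for a b k y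
  proof -
    have k: "real k / n = real (k mod n) / n + real (k div n)"
    proof -
      have "real k = real (k div n) * n + real (k mod n)"
        by (metis div_mult_mod_eq of_nat_add of_nat_mult)
      then show ?thesis using \<open>n > 0\<close> by (simp add: field_simps)
    qed
    have "H a b (k / n) y = H a b (real (k mod n) / n) (y - of_nat (k div n))"
      using sh[of a b "real (k mod n) / n" "k div n" "y - of_nat (k div n)"] by (simp add: k)
    also have "\<dots> \<le> H a b (real (k mod n) / n) (best a b (real (k mod n) / n))"
      by (rule best)
    also have "\<dots> = H a b (k / n) (raw a b k)"
      unfolding raw_def k by (rule sh[symmetric])
    finally show ?thesis .
  qed
  define turn where "turn i = i mod (4 * n)" for i
  have turn: "H (real i / n) b c = H (real (turn i) / n) b c" for i b c
  proof -
    have "real i = real (turn i) + 4 * n * real (i div (4 * n))"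
      unfolding turn_def
      by (metis (no_types, lifting) mod_mult_div_eq of_nat_add of_nat_mult of_nat_numeral)
    then have "real i / n = real (turn i) / n + 4 * real (i div (4 * n))"
      using \<open>n > 0\<close> by (simp add: field_simps)
    then show ?thesis using per by simp
  qed
  \<comment> \<open>On the bottom only \<open>i + k\<close> matters, and the second half of the top level is the flipped
    image of the first half.\<close>
  define l where "l i j k =
    (if j = 0 then raw 0 0 (i + k)
     else if j = n \<and> 2 * n \<le> turn i
       then - raw (real (turn i - 2 * n) / n) 1 (n - k)
     else raw (real (turn i) / n) (real j / n) k)" for i j k
  have l_0: "l i 0 k = raw 0 0 (i + k)" for i k
    by (simp add: l_def)
  have raw_full: "raw a b (k + 4 * n) = raw a b k" for a b k
  proof -
    have "k + 4 * n = k + n + n + n + n" by simp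
    then have "raw a b (k + 4 * n) = raw a b k + 4" by (simp only: raw_shift) simp
    then show ?thesis by simp
  qed
  show thesis
  proof (rule that[of l "raw 0 0"])
    fix j k assume "j \<le> n" "k \<le> n"
    have "turn (4 * n) = turn 0" by (simp add: turn_def)
    then show "l (4 * n) j k = l 0 j k"
      using raw_full[of 0 0 k] by (simp add: l_def add.commute)
  next
    fix i j assume "j \<le> n"
    show "l i j n = l i j 0 + 1"
      using \<open>n > 0\<close> raw_shift[of 0 0 i]
        raw_shift[of "(real (turn i) - 2 * real n) / n" 1 0]
        raw_shift[of "real (turn i) / n" "real j / n" 0]
      by (simp add: l_def)
  next
    fix i k assume i: "i \<le> 2 * n" and k: "k \<le> n"
    show "l (i + 2 * n) n (n - k) = - l i n k"
    proof (cases "i = 2 * n")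
      case True
      then have "turn (i + 2 * n) = 0" "turn i = 2 * n"
        using \<open>n > 0\<close> by (simp_all add: turn_def)
      then show ?thesis using \<open>n > 0\<close> by (simp add: l_def)
    next
      case False
      then have "turn (i + 2 * n) = i + 2 * n" "turn i = i" "i < 2 * n"
        using i by (simp_all add: turn_def)
      then show ?thesis using \<open>n > 0\<close> k by (simp add: l_def)
    qed
  next
    show "l i 0 k = raw 0 0 (i + k)" for i k by (rule l_0)
    show "raw 0 0 (m + n) = raw 0 0 m + 1" for m by (rule raw_shift)
  next
    fix i j k y assume j: "j \<le> n" and k: "k \<le> n"
    consider "j = 0" | "j = n" "2 * n \<le> turn i" | "j \<noteq> 0" "\<not> (j = n \<and> 2 * n \<le> turn i)"
      by blast
    then show "H (i / n) (j / n) (k / n) y \<le> H (i / n) (j / n) (k / n) (l i j k)"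
    proof cases
      case 1
      have "real i / n + real k / n = real (i + k) / n" by (simp add: add_divide_distrib)
      then show ?thesis
        using raw[of 0 0 "i + k" y] by (simp add: 1 l_0 collapse[of "i / n"])
    next
      case 2
      define a where "a = real (turn i - 2 * n) / n"
      have a: "real (turn i) / n = a + 2"
        using 2 \<open>n > 0\<close> by (simp add: a_def of_nat_diff field_simps)
      have c: "real (n - k) / n = 1 - real k / n"
        using k \<open>n > 0\<close> by (simp add: of_nat_diff field_simps)
      have *: "H (i / n) (j / n) (k / n) z = H a 1 (real (n - k) / n) (- z)" for z
        unfolding turn[of i] a c
        using flip[of a "- (real k / n)" "- 1 - z"] shift[of a 1 "- (real k / n)" "- 1 - z"] 2 \<open>n > 0\<close>
        by simp
      have "l i j k = - raw a 1 (n - k)"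
        using 2 \<open>n > 0\<close> by (simp add: l_def a_def)
      then show ?thesis unfolding * using raw[of a 1 "n - k" "- y"] by simp
    next
      case 3
      then have "l i j k = raw (real (turn i) / n) (real j / n) k"
        by (auto simp: l_def)
      then show ?thesis unfolding turn[of i] using raw by simp
    qed
  qed
qed

text \<open>On finer and finer grids there are cubes showing all four labels. They accumulate at a point, and
  at that point every one of the four components is a largest one.\<close>

lemma equivariant_coincidence:
  fixes H :: "real \<Rightarrow> real \<Rightarrow> real \<Rightarrow> 4 \<Rightarrow> real"
  assumes cont: "\<And>x. continuous_on UNIV (\<lambda>p. H (fst p) (fst (snd p)) (snd (snd p)) x)"
    and periodic: "\<And>a b c. H (a + 4) b c = H a b c"
    and shift: "\<And>a b c x. H a b (c + 1) (x + 1) = H a b c x"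
    and flip: "\<And>a c x. H (a + 2) 1 (- c) (- 1 - x) = H a 1 c x"
    and collapse: "\<And>a c. H a 0 c = H 0 0 (a + c)"
  shows "\<exists>a b c. \<forall>x y. H a b c x = H a b c y"
proof -
  define G where "G p = H (fst p) (fst (snd p)) (snd (snd p))" for p
  define K :: "(real \<times> real \<times> real) set" where "K = {0..4} \<times> {0..1} \<times> {0..1}"
  have "\<exists>p q. p \<in> K \<and> (\<forall>x. dist (q x) p \<le> 3 / Suc m \<and> (\<forall>y. G (q x) y \<le> G (q x) x))" for m
  proof -
    define n where "n = Suc m"
    have "n > 0" by (simp add: n_def)
    obtain l :: "nat \<Rightarrow> nat \<Rightarrow> nat \<Rightarrow> 4" and L where l:
      "\<And>j k. j \<le> n \<Longrightarrow> k \<le> n \<Longrightarrow> l (4 * n) j k = l 0 j k"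
      "\<And>i j. i \<le> 4 * n \<Longrightarrow> j \<le> n \<Longrightarrow> l i j n = l i j 0 + 1"
      "\<And>i k. i \<le> 2 * n \<Longrightarrow> k \<le> n \<Longrightarrow> l (i + 2 * n) n (n - k) = - l i n k"
      "\<And>i k. i \<le> 4 * n \<Longrightarrow> k \<le> n \<Longrightarrow> l i 0 k = L (i + k)"
      "\<And>m. L (m + n) = L m + 1"
      and best: "\<And>i j k y. j \<le> n \<Longrightarrow> k \<le> n \<Longrightarrow>
       H (i / n) (j / n) (k / n) y \<le> H (i / n) (j / n) (k / n) (l i j k)"
      by (rule equivariant_labels[of H n, OF periodic shift flip collapse \<open>n > 0\<close>]) blast
    from rainbow_cube_exists[of n l L, OF l] obtain i j k where ijk: "i < 4 * n" "j < n" "k < n" and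
      "\<forall>x. \<exists>i'\<in>{i, Suc i}. \<exists>j'\<in>{j, Suc j}. \<exists>k'\<in>{k, Suc k}. l i' j' k' = x"
      by blast
    then obtain i' j' k' where "\<And>x. i' x \<in> {i, Suc i}" "\<And>x. j' x \<in> {j, Suc j}"
      "\<And>x. k' x \<in> {k, Suc k}" and l': "\<And>x. l (i' x) (j' x) (k' x) = x"
      by metis
    then have near: "i \<le> i' x" "i' x \<le> i + 1" "j \<le> j' x" "j' x \<le> j + 1" "k \<le> k' x" "k' x \<le> k + 1" for x
      by (metis add.commute insert_iff le_SucI order_refl plus_1_eq_Suc singletonD)+
    define p where "p = (real i / n, real j / n, real k / n)"
    define q where "q x = (real (i' x) / n, real (j' x) / n, real (k' x) / n)" for x
    have "p \<in> K" using ijk by (simp add: p_def K_def divide_le_eq)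
    moreover have "dist (q x) p \<le> 3 / Suc m" for x
    proof -
      have *: "\<bar>real s / n - real t / n\<bar> \<le> 1 / n" if "t \<le> s" "s \<le> t + 1" for s t
        using that \<open>n > 0\<close> by (simp add: diff_divide_distrib[symmetric] divide_le_cancel)
      have "dist (q x) p \<le> \<bar>real (i' x) / n - real i / n\<bar> +
          (\<bar>real (j' x) / n - real j / n\<bar> + \<bar>real (k' x) / n - real k / n\<bar>)"
        unfolding q_def p_def dist_Pair_Pair dist_real_def
        using sqrt_sum_squares_le_sum_abs[of "\<bar>real (i' x) / n - real i / n\<bar>"
            "sqrt (\<bar>real (j' x) / n - real j / n\<bar>\<^sup>2 + \<bar>real (k' x) / n - real k / n\<bar>\<^sup>2)"]
          sqrt_sum_squares_le_sum_abs[of "\<bar>real (j' x) / n - real j / n\<bar>" "\<bar>real (k' x) / n - real k / n\<bar>"]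
        by simp
      also have "\<dots> \<le> 1 / n + (1 / n + 1 / n)"
        using near by (intro add_mono *) auto
      finally show ?thesis by (simp add: n_def)
    qed
    moreover have "G (q x) y \<le> G (q x) x" for x y
      using best[of "j' x" "k' x" "i' x" y] ijk near[of x] l'[of x] by (simp add: G_def q_def)
    ultimately show ?thesis by blast
  qed
  then obtain p q where p: "\<And>m. p m \<in> K" and q: "\<And>m x. dist (q m x) (p m) \<le> 3 / Suc m"
    and best: "\<And>m x y. G (q m x) y \<le> G (q m x) x"
    by metis
  have "compact K" unfolding K_def by (intro compact_Times compact_Icc)
  then obtain z r where "strict_mono r" and lim: "(p \<circ> r) \<longlonglongrightarrow> z"
    unfolding compact_def using p by metis
  have q_lim: "(\<lambda>m. q (r m) x) \<longlonglongrightarrow> z" for x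
  proof -
    have "(\<lambda>m. 3 / real (Suc m)) \<longlonglongrightarrow> 0"
      by (intro LIMSEQ_Suc lim_const_over_n)
    then have r1: "(\<lambda>m. 3 / real (Suc (r m))) \<longlonglongrightarrow> 0"
      using LIMSEQ_subseq_LIMSEQ[OF _ \<open>strict_mono r\<close>] unfolding o_def by blast
    have r2: "(\<lambda>m. dist (p (r m)) z) \<longlonglongrightarrow> 0"
      using lim unfolding o_def by (simp add: tendsto_dist_iff[symmetric])
    have "norm (dist (q (r m) x) z) \<le> 3 / real (Suc (r m)) + dist (p (r m)) z" for m
      using dist_triangle[of "q (r m) x" z "p (r m)"] q[of "r m" x] by simp
    then have "\<forall>\<^sub>F m in sequentially.
        norm (dist (q (r m) x) z) \<le> 3 / real (Suc (r m)) + dist (p (r m)) z"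
      by (intro always_eventually allI)
    then have "(\<lambda>m. dist (q (r m) x) z) \<longlonglongrightarrow> 0"
      by (rule Lim_null_comparison) (rule tendsto_add[OF r1 r2, unfolded add_0_right])
    then show ?thesis by (simp add: tendsto_dist_iff[symmetric])
  qed
  have G_lim: "(\<lambda>m. G (q (r m) x) y) \<longlonglongrightarrow> G z y" for x y
    using cont[of y] q_lim[of x] unfolding G_def
    by (intro continuous_on_tendsto_compose[of UNIV "\<lambda>p. H (fst p) (fst (snd p)) (snd (snd p)) y"]) auto
  have "G z y \<le> G z x" for x y
    by (rule LIMSEQ_le[OF G_lim[of x y] G_lim[of x x]]) (use best in auto)
  then have "G z x = G z y" for x y by (simp add: order_antisym)
  then show ?thesis unfolding G_def by blast
qed

section \<open>Frames on which an odd function is linear\<close>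

text \<open>For an orthonormal frame, \<open>p - q\<close>, \<open>q - r\<close> and \<open>r - p\<close> form every second vertex of a regular
  hexagon. The twelve vectors \<open>\<plusminus> p \<plusminus> q\<close>, \<open>\<plusminus> p \<plusminus> r\<close>, \<open>\<plusminus> q \<plusminus> r\<close> are the disjoint union of the four
  triples obtained from this one by quarter turns about \<open>r\<close>.\<close>

definition hexagon :: "(real ^ 3 \<Rightarrow> real) \<Rightarrow> real ^ 3 \<Rightarrow> real ^ 3 \<Rightarrow> real ^ 3 \<Rightarrow> real" where
  "hexagon f p q r = f (p - q) + f (q - r) + f (r - p)"

definition hexagons :: "(real ^ 3 \<Rightarrow> real) \<Rightarrow> real ^ 3 \<Rightarrow> real ^ 3 \<Rightarrow> real ^ 3 \<Rightarrow> 4 \<Rightarrow> real" where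
  "hexagons f p q r x =
     (if x = 0 then hexagon f p q r else if x = 1 then hexagon f (- q) p r
      else if x = 2 then hexagon f (- p) (- q) r else hexagon f q (- p) r)"

lemma hexagons_quarter_turn: "hexagons f q (- p) r (x + 1) = hexagons f p q r x"
proof -
  have "\<forall>x. hexagons f q (- p) r (x + 1) = hexagons f p q r x"
    unfolding all_4 by (simp add: hexagons_def)
  then show ?thesis by blast
qed

text \<open>The quarter turn permutes the triples by construction; the half turn about \<open>p\<close> does so because
  it exchanges the first triple with the fourth and the second with the third.\<close>

lemma hexagons_half_turn: "hexagons f p (- q) (- r) (- 1 - x) = hexagons f p q r x"
proof -
  have "\<forall>x. hexagons f p (- q) (- r) (- 1 - x) = hexagons f p q r x"
    unfolding all_4 by (simp add: hexagons_def hexagon_def add_ac minus_diff_commute)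
  then show ?thesis by blast
qed

text \<open>The four triples make up all twelve vectors, which come in opposite pairs; so for an odd \<open>f\<close> the
  four sums add up to 0, and if they are equal they all vanish. Three of the six values of \<open>f\<close>
  determine \<open>a\<close>, \<open>b\<close>, \<open>c\<close>, and the vanishing sums give the other three.\<close>

lemma linear_of_equal_hexagons:
  assumes odd: "\<And>u. f (- u) = - f u"
    and eq: "\<And>x y. hexagons f p q r x = hexagons f p q r y"
  obtains a b c where
    "f (p + q) = a + b" "f (p - q) = a - b" "f (q + r) = b + c" "f (q - r) = b - c"
    "f (p + r) = a + c" "f (p - r) = a - c"
proof -
  have flip: "f (q - p) = - f (p - q)" "f (r - p) = - f (p - r)" "f (r - q) = - f (q - r)"
    "f (- p - q) = - f (p + q)" "f (- p - r) = - f (p + r)" "f (- q - r) = - f (q + r)"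
    "f (- q - p) = - f (p + q)" "f (- r - p) = - f (p + r)" "f (- r - q) = - f (q + r)"
    using odd[of "p - q"] odd[of "p - r"] odd[of "q - r"] odd[of "p + q"] odd[of "p + r"] odd[of "q + r"]
    by (simp_all add: minus_diff_commute)
  have "hexagons f p q r 0 = f (p - q) + f (q - r) - f (p - r)"
    "hexagons f p q r 1 = - f (p + q) + f (p - r) + f (q + r)"
    "hexagons f p q r 2 = - f (p - q) - f (q + r) + f (p + r)"
    "hexagons f p q r 3 = f (p + q) - f (p + r) - f (q - r)"
    by (simp_all add: hexagons_def hexagon_def flip add.commute)
  with eq[of 0 1] eq[of 0 2] eq[of 0 3] show thesis
    by (intro that[of "(f (p + q) + f (p - q)) / 2" "(f (p + q) - f (p - q)) / 2"
        "(f (p + q) - f (p - q)) / 2 - f (q - r)"]) (simp_all add: field_simps)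
qed

definition horizontal :: "real \<Rightarrow> real ^ 3" where
  "horizontal A = cos A *\<^sub>R axis 1 1 + sin A *\<^sub>R axis 2 1"

text \<open>The frame \<open>euler_x\<close>, \<open>euler_y\<close>, \<open>euler_z\<close> consists of the columns of the rotation
  with Euler angles \<open>A\<close>, \<open>B\<close>, \<open>C\<close> about the third, the second and again the third axis. In these
  coordinates the quarter turn about the last frame vector is a translation
  of \<open>C\<close>, and at \<open>B = \<pi>/2\<close> the half turn about the first one is the map
  \<open>(A, C) \<mapsto> (A + \<pi>, - C)\<close>; both preserve a grid.\<close>

definition euler_z :: "real \<Rightarrow> real \<Rightarrow> real ^ 3" where
  "euler_z A B = sin B *\<^sub>R horizontal A + cos B *\<^sub>R axis 3 1"

definition euler_x :: "real \<Rightarrow> real \<Rightarrow> real \<Rightarrow> real ^ 3" where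
  "euler_x A B C = cos C *\<^sub>R (cos B *\<^sub>R horizontal A - sin B *\<^sub>R axis 3 1)
     + sin C *\<^sub>R (cos A *\<^sub>R axis 2 1 - sin A *\<^sub>R axis 1 1)"

definition euler_y :: "real \<Rightarrow> real \<Rightarrow> real \<Rightarrow> real ^ 3" where
  "euler_y A B C = cos C *\<^sub>R (cos A *\<^sub>R axis 2 1 - sin A *\<^sub>R axis 1 1)
     - sin C *\<^sub>R (cos B *\<^sub>R horizontal A - sin B *\<^sub>R axis 3 1)"

lemma euler_orthonormal:
  "norm (euler_x A B C) = 1" "norm (euler_y A B C) = 1" "norm (euler_z A B) = 1"
  "euler_x A B C \<bullet> euler_y A B C = 0" "euler_x A B C \<bullet> euler_z A B = 0"
  "euler_y A B C \<bullet> euler_z A B = 0"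
proof -
  define h t e u where h: "h = horizontal A" and t: "t = cos A *\<^sub>R axis 2 1 - sin A *\<^sub>R (axis 1 1 :: real ^ 3)"
    and e: "e = (axis 3 1 :: real ^ 3)" and u: "u = cos B *\<^sub>R h - sin B *\<^sub>R e"
  have hte: "h \<bullet> h = 1" "t \<bullet> t = 1" "e \<bullet> e = 1" "h \<bullet> t = 0" "h \<bullet> e = 0" "t \<bullet> e = 0"
    by (simp_all add: h t e horizontal_def inner_vec_def sum_3 axis_def sin_cos_squared_add3)
      (simp_all add: sin_cos_squared_add3 add.commute)
  then have hte': "t \<bullet> h = 0" "e \<bullet> h = 0" "e \<bullet> t = 0"
    by (simp_all add: inner_commute)
  have ut: "u \<bullet> u = 1" "u \<bullet> t = 0" "t \<bullet> u = 0" "u \<bullet> euler_z A B = 0" "t \<bullet> euler_z A B = 0"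
    by (simp_all add: u euler_z_def flip: h e)
      (simp_all add: inner_add_left inner_add_right inner_diff_left inner_diff_right hte hte'
        sin_cos_squared_add3 mult.commute)
  have x: "euler_x A B C = cos C *\<^sub>R u + sin C *\<^sub>R t" for C
    by (simp add: euler_x_def u h t e)
  have y: "euler_y A B C = cos C *\<^sub>R t - sin C *\<^sub>R u"
    by (simp add: euler_y_def u h t e)
  show "norm (euler_z A B) = 1"
    unfolding norm_eq_1 euler_z_def h[symmetric] e[symmetric]
    by (simp add: inner_add_left inner_add_right hte hte') (simp add: sin_cos_squared_add3 add.commute)
  show "norm (euler_x A B C) = 1" "norm (euler_y A B C) = 1"
    unfolding norm_eq_1 x y
    by (simp_all add: inner_add_left inner_add_right inner_diff_left inner_diff_right hte ut
        sin_cos_squared_add3)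
  show "euler_x A B C \<bullet> euler_y A B C = 0" "euler_x A B C \<bullet> euler_z A B = 0"
    "euler_y A B C \<bullet> euler_z A B = 0"
    unfolding x y
    by (simp_all add: inner_add_left inner_diff_left inner_add_right inner_diff_right hte ut)
qed

lemma euler_periodic:
  "euler_x (A + 2 * pi) B C = euler_x A B C" "euler_y (A + 2 * pi) B C = euler_y A B C"
  "euler_z (A + 2 * pi) B = euler_z A B"
  by (simp_all add: euler_x_def euler_y_def euler_z_def horizontal_def cos_add sin_add)

lemma euler_quarter_turn:
  "euler_x A B (C + pi / 2) = euler_y A B C" "euler_y A B (C + pi / 2) = - euler_x A B C"
  by (simp_all add: euler_x_def euler_y_def cos_add sin_add algebra_simps)

lemma euler_half_turn:
  "euler_x (A + pi) (pi / 2) (- C) = euler_x A (pi / 2) C"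
  "euler_y (A + pi) (pi / 2) (- C) = - euler_y A (pi / 2) C"
  "euler_z (A + pi) (pi / 2) = - euler_z A (pi / 2)"
  by (simp_all add: euler_x_def euler_y_def euler_z_def horizontal_def cos_add sin_add algebra_simps)

text \<open>For \<open>B = 0\<close> both remaining rotations are about the same axis.\<close>

lemma euler_collapse:
  "euler_x A 0 C = euler_x 0 0 (A + C)" "euler_y A 0 C = euler_y 0 0 (A + C)"
  "euler_z A 0 = euler_z 0 0"
  by (simp_all add: euler_x_def euler_y_def euler_z_def horizontal_def cos_add sin_add algebra_simps)

text \<open>Agreement with a linear function at six vectors imposes three conditions on the frame, as many as
  there are Euler angles. A coincidence of the four hexagon sums meets them.\<close>

lemma odd_function_linear_on_frame_sums:
  fixes f :: "real ^ 3 \<Rightarrow> real"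
  assumes cont: "continuous_on UNIV f" and odd: "\<And>u. f (- u) = - f u"
  obtains p q r v where
    "norm p = 1" "norm q = 1" "norm r = 1" "p \<bullet> q = 0" "p \<bullet> r = 0" "q \<bullet> r = 0"
    "f (p + q) = v \<bullet> (p + q)" "f (p - q) = v \<bullet> (p - q)" "f (q + r) = v \<bullet> (q + r)"
    "f (q - r) = v \<bullet> (q - r)" "f (p + r) = v \<bullet> (p + r)" "f (p - r) = v \<bullet> (p - r)"
proof -
  define H where "H a b c = hexagons f (euler_x (pi / 2 * a) (pi / 2 * b) (pi / 2 * c))
    (euler_y (pi / 2 * a) (pi / 2 * b) (pi / 2 * c)) (euler_z (pi / 2 * a) (pi / 2 * b))" for a b c
  have "\<exists>a b c. \<forall>x y. H a b c x = H a b c y"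
  proof (rule equivariant_coincidence)
    have f: "continuous_on UNIV (\<lambda>p. f (g p))" if "continuous_on UNIV g"
      for g :: "real \<times> real \<times> real \<Rightarrow> real ^ 3"
      using continuous_on_compose2[OF cont that] by simp
    show "continuous_on UNIV (\<lambda>p. H (fst p) (fst (snd p)) (snd (snd p)) x)" for x
    proof -
      define X Y Z where X: "X p = euler_x (pi / 2 * fst p) (pi / 2 * fst (snd p)) (pi / 2 * snd (snd p))"
        and Y: "Y p = euler_y (pi / 2 * fst p) (pi / 2 * fst (snd p)) (pi / 2 * snd (snd p))"
        and Z: "Z p = euler_z (pi / 2 * fst p) (pi / 2 * fst (snd p))"
        for p :: "real \<times> real \<times> real"
      have e: "continuous_on UNIV X" "continuous_on UNIV Y" "continuous_on UNIV Z"
        unfolding X Y Z euler_x_def euler_y_def euler_z_def horizontal_def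
        by (intro continuous_intros)+
      have H: "H (fst p) (fst (snd p)) (snd (snd p)) x = hexagons f (X p) (Y p) (Z p) x" for p
        by (simp only: H_def X Y Z)
      show ?thesis
        unfolding H hexagons_def hexagon_def
        by (cases "x = 0"; cases "x = 1"; cases "x = 2"; simp; intro continuous_intros f e)
    qed
    show "H (a + 4) b c = H a b c" for a b c
    proof -
      have "pi / 2 * (a + 4) = pi / 2 * a + 2 * pi" by (simp add: algebra_simps)
      then show ?thesis by (simp only: H_def euler_periodic)
    qed
    show "H a b (c + 1) (x + 1) = H a b c x" for a b c x
    proof -
      have "pi / 2 * (c + 1) = pi / 2 * c + pi / 2" by (simp add: algebra_simps)
      then show ?thesis by (simp only: H_def euler_quarter_turn hexagons_quarter_turn)
    qed
    show "H (a + 2) 1 (- c) (- 1 - x) = H a 1 c x" for a c x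
    proof -
      have "pi / 2 * (a + 2) = pi / 2 * a + pi" "pi / 2 * (- c) = - (pi / 2 * c)"
        by (simp_all add: algebra_simps)
      then show ?thesis by (simp only: H_def euler_half_turn hexagons_half_turn mult_1_right)
    qed
    show "H a 0 c = H 0 0 (a + c)" for a c
      by (simp only: H_def mult_zero_right euler_collapse[of "pi / 2 * a"] distrib_left)
  qed
  then obtain a b c where eq: "\<And>x y. H a b c x = H a b c y" by blast
  define p q r where pqr: "p = euler_x (pi / 2 * a) (pi / 2 * b) (pi / 2 * c)"
    "q = euler_y (pi / 2 * a) (pi / 2 * b) (pi / 2 * c)"
    "r = euler_z (pi / 2 * a) (pi / 2 * b)"
  note on = euler_orthonormal(1,2,4,5,6)[of "pi / 2 * a" "pi / 2 * b" "pi / 2 * c", folded pqr]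
    euler_orthonormal(3)[of "pi / 2 * a" "pi / 2 * b", folded pqr]
  from eq have "\<And>x y. hexagons f p q r x = hexagons f p q r y"
    unfolding H_def pqr by blast
  from linear_of_equal_hexagons[OF odd this] obtain s t u where
    "f (p + q) = s + t" "f (p - q) = s - t" "f (q + r) = t + u" "f (q - r) = t - u"
    "f (p + r) = s + u" "f (p - r) = s - u" by blast
  moreover have "(s *\<^sub>R p + t *\<^sub>R q + u *\<^sub>R r) \<bullet> p = s" "(s *\<^sub>R p + t *\<^sub>R q + u *\<^sub>R r) \<bullet> q = t"
    "(s *\<^sub>R p + t *\<^sub>R q + u *\<^sub>R r) \<bullet> r = u"
    using on by (simp_all add: inner_add_left norm_eq_1 inner_commute[of q p]
        inner_commute[of r p] inner_commute[of r q])
  ultimately show thesis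
    using on by (intro that[of p q r "s *\<^sub>R p + t *\<^sub>R q + u *\<^sub>R r"])
      (simp_all only: inner_add_right inner_diff_right)
qed

section \<open>Covering by the rhombic dodecahedron\<close>

text \<open>With \<open>h\<close> the support function of \<open>X\<close>, the values \<open>p \<bullet> u\<close> for \<open>p \<in> X\<close> fill at most the interval from
  \<open>- h (- u)\<close> to \<open>h u\<close>, of length at most \<open>norm u\<close>; its midpoint is an odd function of \<open>u\<close>.\<close>

lemma odd_midpoint_of_widths:
  fixes X :: "'a::real_inner set"
  assumes "bounded X" "X \<noteq> {}" "diameter X \<le> 1"
  obtains f where "continuous_on UNIV f" "\<And>u. f (- u) = - f u"
    "\<And>p u. p \<in> X \<Longrightarrow> \<bar>p \<bullet> u - f u\<bar> \<le> norm u / 2"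
proof -
  obtain M where M: "\<And>p. p \<in> X \<Longrightarrow> norm p \<le> M" and "M \<ge> 0"
    using \<open>bounded X\<close> unfolding bounded_pos by (metis less_imp_le)
  define h where "h u = (SUP p\<in>X. p \<bullet> u)" for u
  have inner_le: "p \<bullet> u \<le> M * norm u" if "p \<in> X" for p u
    using norm_cauchy_schwarz[of p u] M[OF that] mult_right_mono[of "norm p" M "norm u"] by simp
  have h: "p \<bullet> u \<le> h u" if "p \<in> X" for p u
    unfolding h_def using that inner_le by (intro cSUP_upper bdd_aboveI2)
  have h_diff: "h u \<le> h v + M * norm (u - v)" for u v
    unfolding h_def[of u]
  proof (rule cSUP_least[OF \<open>X \<noteq> {}\<close>])
    fix p assume "p \<in> X"
    then show "p \<bullet> u \<le> h v + M * norm (u - v)"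
      using h[of p v] inner_le[of p "u - v"] by (simp add: inner_diff_right)
  qed
  have "M-lipschitz_on UNIV h"
  proof (rule lipschitz_onI)
    show "dist (h u) (h v) \<le> M * dist u v" for u v
      using h_diff[of u v] h_diff[of v u] by (simp add: dist_norm norm_minus_commute abs_le_iff)
  qed (rule \<open>M \<ge> 0\<close>)
  then have "continuous_on UNIV h" by (rule lipschitz_on_continuous_on)
  moreover from this have "continuous_on UNIV (\<lambda>u. h (- u))"
    by (rule continuous_on_compose2) (auto intro: continuous_intros)
  ultimately have cont: "continuous_on UNIV (\<lambda>u. (h u - h (- u)) / 2)"
    by (intro continuous_intros) auto
  have width: "h u + h (- u) \<le> norm u" for u
  proof -
    have "h u \<le> norm u - h (- u)"
      unfolding h_def[of u]
    proof (rule cSUP_least[OF \<open>X \<noteq> {}\<close>])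
      fix p assume p: "p \<in> X"
      have "h (- u) \<le> norm u - p \<bullet> u"
        unfolding h_def
      proof (rule cSUP_least[OF \<open>X \<noteq> {}\<close>])
        fix q assume "q \<in> X"
        then have "norm (p - q) \<le> 1"
          using diameter_bounded_bound[OF \<open>bounded X\<close> p] \<open>diameter X \<le> 1\<close> by (force simp: dist_norm)
        then have "(p - q) \<bullet> u \<le> norm u"
          using norm_cauchy_schwarz[of "p - q" u] mult_right_mono[of "norm (p - q)" 1 "norm u"] by simp
        then show "q \<bullet> - u \<le> norm u - p \<bullet> u" by (simp add: inner_diff_left)
      qed
      then show "p \<bullet> u \<le> norm u - h (- u)" by simp
    qed
    then show ?thesis by simp
  qed
  show thesis
  proof (rule that[OF cont])
    fix p u assume "p \<in> X"
    then have "p \<bullet> u \<le> h u" "- (p \<bullet> u) \<le> h (- u)" using h[of p "- u"] h by simp_all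
    with width[of u] show "\<bar>p \<bullet> u - (h u - h (- u)) / 2\<bar> \<le> norm u / 2"
      by (simp add: abs_le_iff field_simps)
  qed (simp add: field_simps)
qed

definition matrix_of_columns :: "real ^ 3 \<Rightarrow> real ^ 3 \<Rightarrow> real ^ 3 \<Rightarrow> real ^ 3 ^ 3" where
  "matrix_of_columns p q r = (\<chi> i j. (if j = 1 then p else if j = 2 then q else r) $ i)"

lemma orthogonal_matrix_of_columns:
  assumes "norm p = 1" "norm q = 1" "norm r = 1" "p \<bullet> q = 0" "p \<bullet> r = 0" "q \<bullet> r = 0"
  shows "orthogonal_matrix (matrix_of_columns p q r)"
proof -
  have "column 1 (matrix_of_columns p q r) = p" "column 2 (matrix_of_columns p q r) = q"
    "column 3 (matrix_of_columns p q r) = r"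
    by (simp_all add: column_def matrix_of_columns_def vec_eq_iff)
  then show ?thesis
    using assms
    by (simp add: orthogonal_matrix_orthonormal_columns forall_3 orthogonal_def inner_commute)
qed

lemma transpose_matrix_of_columns_mult:
  "(transpose (matrix_of_columns p q r) *v x) $ 1 = p \<bullet> x"
  "(transpose (matrix_of_columns p q r) *v x) $ 2 = q \<bullet> x"
  "(transpose (matrix_of_columns p q r) *v x) $ 3 = r \<bullet> x"
  by (simp_all add: matrix_vector_mult_def transpose_def matrix_of_columns_def inner_vec_def)

lemma mem_orthogonal_image_iff:
  fixes A :: "real ^ 'n ^ 'n"
  assumes "orthogonal_matrix A"
  shows "x \<in> (\<lambda>y. A *v y + v) ` C \<longleftrightarrow> transpose A *v (x - v) \<in> C"
proof -
  have A: "transpose A *v (A *v y) = y" "A *v (transpose A *v y) = y" for y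
    using assms
    by (simp_all only: orthogonal_matrix_def matrix_vector_mul_assoc matrix_vector_mul_lid)
  show ?thesis
  proof
    assume "transpose A *v (x - v) \<in> C"
    then show "x \<in> (\<lambda>y. A *v y + v) ` C"
      by (rule rev_image_eqI) (simp only: A diff_add_cancel)
  qed (auto simp: A simp del: transpose_matrix_vector)
qed

lemma universal_cover_orthogonal_image:
  fixes C :: "(real ^ 'n) set"
  assumes "universal_cover C" "orthogonal_matrix B"
  shows "universal_cover ((\<lambda>y. B *v y + m) ` C)"
  unfolding universal_cover_def
proof (intro allI impI)
  fix X :: "(real ^ 'n) set"
  assume "bounded X \<and> diameter X \<le> 1"
  then obtain A x where A: "orthogonal_matrix A" and X: "X \<subseteq> (\<lambda>y. A *v y + x) ` C"
    using assms(1) unfolding universal_cover_def by blast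
  define A' where "A' = A ** transpose B"
  have eq: "A' *v (B *v y + m) + (x - A' *v m) = A *v y + x" for y
  proof -
    have "A' *v (B *v y) = A *v y"
      using assms(2)
      by (simp add: A'_def orthogonal_matrix_def matrix_vector_mul_assoc flip: matrix_mul_assoc)
    then show ?thesis by (simp add: matrix_vector_right_distrib)
  qed
  have "(\<lambda>y. A *v y + x) ` C = (\<lambda>y. A' *v y + (x - A' *v m)) ` (\<lambda>y. B *v y + m) ` C"
    by (simp only: image_image eq)
  moreover have "orthogonal_matrix A'"
    unfolding A'_def using A assms(2) by (simp add: orthogonal_matrix_mul)
  ultimately show "\<exists>A x'. orthogonal_matrix A \<and> X \<subseteq> (\<lambda>y. A *v y + x') ` (\<lambda>y. B *v y + m) ` C"
    using X by metis
qed

definition standard_dodecahedron :: "(real ^ 3) set" where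
  "standard_dodecahedron =
     {x. \<forall>i j. i \<noteq> j \<longrightarrow> \<bar>x $ i + x $ j\<bar> \<le> sqrt 2 / 2 \<and> \<bar>x $ i - x $ j\<bar> \<le> sqrt 2 / 2}"

lemma mem_standard_dodecahedron_iff:
  "x \<in> standard_dodecahedron \<longleftrightarrow>
     \<bar>x $ 1 + x $ 2\<bar> \<le> sqrt 2 / 2 \<and> \<bar>x $ 1 - x $ 2\<bar> \<le> sqrt 2 / 2 \<and>
     \<bar>x $ 1 + x $ 3\<bar> \<le> sqrt 2 / 2 \<and> \<bar>x $ 1 - x $ 3\<bar> \<le> sqrt 2 / 2 \<and>
     \<bar>x $ 2 + x $ 3\<bar> \<le> sqrt 2 / 2 \<and> \<bar>x $ 2 - x $ 3\<bar> \<le> sqrt 2 / 2"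
  unfolding standard_dodecahedron_def mem_Collect_eq forall_3
  by (auto simp: abs_minus_commute add.commute)

text \<open>Place the dodecahedron with centre \<open>v\<close> and axes along the frame on which the midpoint function of
  \<open>X\<close> agrees with \<open>u \<mapsto> v \<bullet> u\<close>. The six strips between opposite faces are then centred at the midpoints
  of the widths of \<open>X\<close> in the directions of length \<open>\<surd>2\<close> normal to the faces.\<close>

lemma universal_cover_standard_dodecahedron:
  "universal_cover standard_dodecahedron"
  unfolding universal_cover_def
proof (intro allI impI)
  fix X :: "(real ^ 3) set"
  assume X: "bounded X \<and> diameter X \<le> 1"
  show "\<exists>A x. orthogonal_matrix A \<and> X \<subseteq> (\<lambda>y. A *v y + x) ` standard_dodecahedron"
  proof (cases "X = {}")
    case True
    then show ?thesis using orthogonal_matrix_id by blast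
  next
    case False
    with X obtain f where f: "continuous_on UNIV f" "\<And>u. f (- u) = - f u"
      and mid: "\<And>p u. p \<in> X \<Longrightarrow> \<bar>p \<bullet> u - f u\<bar> \<le> norm u / 2"
      using odd_midpoint_of_widths[of X] by metis
    obtain p q r v where
      on: "norm p = 1" "norm q = 1" "norm r = 1" "p \<bullet> q = 0" "p \<bullet> r = 0" "q \<bullet> r = 0"
      and lin: "f (p + q) = v \<bullet> (p + q)" "f (p - q) = v \<bullet> (p - q)" "f (q + r) = v \<bullet> (q + r)"
        "f (q - r) = v \<bullet> (q - r)" "f (p + r) = v \<bullet> (p + r)" "f (p - r) = v \<bullet> (p - r)"
      by (rule odd_function_linear_on_frame_sums[OF f])
    have len: "norm (a + b) = sqrt 2" "norm (a - b) = sqrt 2"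
      if "norm a = 1" "norm b = 1" "a \<bullet> b = 0" for a b :: "real ^ 3"
      using that by (simp_all add: norm_eq_sqrt_inner inner_add_left inner_add_right
          inner_diff_left inner_diff_right inner_commute)
    have close: "\<bar>u \<bullet> (z - v)\<bar> \<le> sqrt 2 / 2" if "z \<in> X" "f u = v \<bullet> u" "norm u = sqrt 2" for z u
      using mid[OF that(1), of u] that(2,3) by (simp add: inner_diff_right inner_commute)
    have "transpose (matrix_of_columns p q r) *v (z - v) \<in> standard_dodecahedron" if "z \<in> X" for z
      unfolding mem_standard_dodecahedron_iff transpose_matrix_of_columns_mult
        inner_add_left[symmetric] inner_diff_left[symmetric]
      using that on lin by (intro conjI close len)
    then have "X \<subseteq> (\<lambda>y. matrix_of_columns p q r *v y + v) ` standard_dodecahedron"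
      using orthogonal_matrix_of_columns[OF on] by (auto simp: mem_orthogonal_image_iff)
    then show ?thesis using orthogonal_matrix_of_columns[OF on] by blast
  qed
qed

text \<open>The strips are described from the end points of the edges. Seen from a point \<open>m\<close> halfway
  between the bounding planes, such as the centre of the tetrahedron, they are symmetric.\<close>

lemma mem_strip_iff_central:
  assumes "norm (q - p) = 1" "(p - m) \<bullet> (q - p) = - 1 / 2"
  shows "x \<in> strip p q \<longleftrightarrow> \<bar>(x - m) \<bullet> (q - p)\<bar> \<le> 1 / 2"
proof -
  have "q \<bullet> (q - p) - p \<bullet> (q - p) = 1"
    using assms(1) by (simp add: norm_eq_1 flip: inner_diff_left)
  with assms(2) show ?thesis
    unfolding strip_def mem_Collect_eq inner_diff_left abs_le_iff
    by (intro iffI conjI; elim conjE; linarith)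
qed

text \<open>A regular tetrahedron sits in a cube whose edge directions are the sums of opposite
  tetrahedron edges, suitably oriented. In the coordinate system of that cube, centred at the
  centroid, the tetrahedron edges run along the sums and differences of two axes.\<close>

lemma unit_rhombic_dodecahedron_congruent_standard:
  assumes "unit_rhombic_dodecahedron U"
  obtains B m where "orthogonal_matrix B" "U = (\<lambda>y. B *v y + m) ` standard_dodecahedron"
proof -
  obtain v where tet: "unit_regular_tetrahedron v"
    and U: "U = (\<Inter>i\<in>{1..4}. \<Inter>j\<in>{i<..4}. strip (v i) (v j))"
    using assms unfolding unit_rhombic_dodecahedron_def by blast
  define w1 w2 w3 where w: "w1 = v 1 - v 4" "w2 = v 2 - v 4" "w3 = v 3 - v 4"
  have four: "{1..4} = {1, 2, 3, 4::nat}" by auto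
  have later: "{1::nat<..4} = {2, 3, 4}" "{Suc 0<..4} = {2, 3, 4}" "{2::nat<..4} = {3, 4}"
    "{3::nat<..4} = {4}" "{4::nat<..4} = {}"
    by auto
  have edges: "dist (v 1) (v 2) = 1" "dist (v 1) (v 3) = 1" "dist (v 1) (v 4) = 1"
    "dist (v 2) (v 3) = 1" "dist (v 2) (v 4) = 1" "dist (v 3) (v 4) = 1"
    using tet unfolding unit_regular_tetrahedron_def by auto
  have d: "w1 - w2 = v 1 - v 2" "w1 - w3 = v 1 - v 3" "w2 - w3 = v 2 - v 3"
    by (simp_all add: w)
  have n: "norm w1 = 1" "norm w2 = 1" "norm w3 = 1"
    "norm (w1 - w2) = 1" "norm (w1 - w3) = 1" "norm (w2 - w3) = 1"
    unfolding d unfolding w using edges by (simp_all add: dist_norm)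
  have g: "w1 \<bullet> w1 = 1" "w2 \<bullet> w2 = 1" "w3 \<bullet> w3 = 1"
    "w1 \<bullet> w2 = 1 / 2" "w1 \<bullet> w3 = 1 / 2" "w2 \<bullet> w3 = 1 / 2"
    using n by (simp_all add: norm_eq_1 inner_diff_left inner_diff_right inner_commute)
  then have g': "w2 \<bullet> w1 = 1 / 2" "w3 \<bullet> w1 = 1 / 2" "w3 \<bullet> w2 = 1 / 2"
    by (simp_all add: inner_commute)
  define c :: real where "c = sqrt 2 / 2"
  have c: "c > 0" "c * c = 1 / 2" by (simp_all add: c_def)
  \<comment> \<open>The edge directions of the cube, with \<open>w1 + w2 - w3 = (v 1 - v 3) + (v 2 - v 4)\<close>.\<close>
  define b1 b2 b3 where b: "b1 = c *\<^sub>R (w1 + w2 - w3)" "b2 = c *\<^sub>R (w1 - w2 + w3)"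
    "b3 = c *\<^sub>R (w2 + w3 - w1)"
  define m where "m = v 4 + (1 / 4) *\<^sub>R (w1 + w2 + w3)"
  note bilinear = inner_add_left inner_add_right inner_diff_left inner_diff_right
  have on: "norm b1 = 1" "norm b2 = 1" "norm b3 = 1" "b1 \<bullet> b2 = 0" "b1 \<bullet> b3 = 0" "b2 \<bullet> b3 = 0"
    unfolding norm_eq_1 b
    using c(2) by (simp_all add: bilinear g g' algebra_simps)
  have v: "v 1 = m + (w1 - (1 / 4) *\<^sub>R (w1 + w2 + w3))" "v 2 = m + (w2 - (1 / 4) *\<^sub>R (w1 + w2 + w3))"
    "v 3 = m + (w3 - (1 / 4) *\<^sub>R (w1 + w2 + w3))" "v 4 = m - (1 / 4) *\<^sub>R (w1 + w2 + w3)"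
    by (simp_all add: m_def w)
  have scale: "\<bar>2 * c * t\<bar> \<le> sqrt 2 / 2 \<longleftrightarrow> \<bar>t\<bar> \<le> 1 / 2" for t
  proof -
    have "\<bar>2 * c * t\<bar> \<le> sqrt 2 / 2 \<longleftrightarrow> c * (2 * \<bar>t\<bar>) \<le> c * 1"
      using c(1) by (simp add: abs_mult flip: c_def)
    also have "\<dots> \<longleftrightarrow> \<bar>t\<bar> \<le> 1 / 2"
      using c(1) by (subst mult_le_cancel_left_pos) auto
    finally show ?thesis .
  qed
  have "x \<in> U \<longleftrightarrow> x \<in> (\<lambda>y. matrix_of_columns b1 b2 b3 *v y + m) ` standard_dodecahedron" for x
  proof -
    define t1 t2 t3 where t: "t1 = w1 \<bullet> (x - m)" "t2 = w2 \<bullet> (x - m)" "t3 = w3 \<bullet> (x - m)"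
    have diffs: "v 2 - v 1 = w2 - w1" "v 3 - v 1 = w3 - w1" "v 4 - v 1 = - w1"
      "v 3 - v 2 = w3 - w2" "v 4 - v 2 = - w2" "v 4 - v 3 = - w3"
      by (simp_all add: w)
    have strip: "x \<in> strip (v i) (v j) \<longleftrightarrow> \<bar>s\<bar> \<le> 1 / 2"
      if "v j - v i = e" "v i = m + a" "e \<bullet> (x - m) = s" "norm e = 1" "a \<bullet> e = - 1 / 2" for i j e a s
      using mem_strip_iff_central[of "v j" "v i" m x] that by (simp add: inner_commute)
    have strips: "x \<in> strip (v 1) (v 2) \<longleftrightarrow> \<bar>t2 - t1\<bar> \<le> 1 / 2"
      "x \<in> strip (v 1) (v 3) \<longleftrightarrow> \<bar>t3 - t1\<bar> \<le> 1 / 2"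
      "x \<in> strip (v 1) (v 4) \<longleftrightarrow> \<bar>- t1\<bar> \<le> 1 / 2"
      "x \<in> strip (v 2) (v 3) \<longleftrightarrow> \<bar>t3 - t2\<bar> \<le> 1 / 2"
      "x \<in> strip (v 2) (v 4) \<longleftrightarrow> \<bar>- t2\<bar> \<le> 1 / 2"
      "x \<in> strip (v 3) (v 4) \<longleftrightarrow> \<bar>- t3\<bar> \<le> 1 / 2"
      by (rule strip[OF diffs(1) v(1)] strip[OF diffs(2) v(1)] strip[OF diffs(3) v(1)]
          strip[OF diffs(4) v(2)] strip[OF diffs(5) v(2)] strip[OF diffs(6) v(3)],
          simp add: t inner_diff_left, simp add: n norm_minus_commute, simp add: bilinear g g')+
    have coords: "b1 \<bullet> (x - m) + b2 \<bullet> (x - m) = 2 * c * t1" "b1 \<bullet> (x - m) - b2 \<bullet> (x - m) = 2 * c * (t2 - t3)"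
      "b1 \<bullet> (x - m) + b3 \<bullet> (x - m) = 2 * c * t2" "b1 \<bullet> (x - m) - b3 \<bullet> (x - m) = 2 * c * (t1 - t3)"
      "b2 \<bullet> (x - m) + b3 \<bullet> (x - m) = 2 * c * t3" "b2 \<bullet> (x - m) - b3 \<bullet> (x - m) = 2 * c * (t1 - t2)"
      by (simp_all only: b t inner_scaleR_left inner_add_left inner_diff_left) (simp_all add: algebra_simps)
    have "x \<in> U \<longleftrightarrow> x \<in> strip (v 1) (v 2) \<and> x \<in> strip (v 1) (v 3) \<and> x \<in> strip (v 1) (v 4)
        \<and> x \<in> strip (v 2) (v 3) \<and> x \<in> strip (v 2) (v 4) \<and> x \<in> strip (v 3) (v 4)"
      unfolding U four by (simp add: later)
    also have "\<dots> \<longleftrightarrow> transpose (matrix_of_columns b1 b2 b3) *v (x - m) \<in> standard_dodecahedron"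
      unfolding strips mem_standard_dodecahedron_iff transpose_matrix_of_columns_mult coords scale
      by (auto simp: abs_minus_commute)
    finally show ?thesis
      by (simp add: mem_orthogonal_image_iff orthogonal_matrix_of_columns on)
  qed
  then show thesis
    using orthogonal_matrix_of_columns[OF on] by (intro that) auto
qed

theorem theorem3:
  fixes U :: "(real ^ 3) set"
  assumes "unit_rhombic_dodecahedron U"
  shows "universal_cover U"
proof -
  obtain B m where "orthogonal_matrix B" "U = (\<lambda>y. B *v y + m) ` standard_dodecahedron"
    using assms by (rule unit_rhombic_dodecahedron_congruent_standard)
  then show ?thesis
    using universal_cover_orthogonal_image[OF universal_cover_standard_dodecahedron] by simp
qed

end
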